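(* Let $\mathcal{A}$ be a tense distributive lattice and $\mathbf{X}=(X,\le,R)$ a $\mathbf{tDL}$-frame. Then: (1) the canonical frame $\mathfrak{M}(\mathcal{A})$ is a $\mathbf{tDL}$-frame; (2) the complex algebra $\mathfrak{C}(\mathbf{X})$ is a tense distributive lattice; (3) the map $h_A:\mathcal{A}\to\mathfrak{C}(\mathfrak{M}(\mathcal{A}))$, $h_A(a)=\{T\in X(A):a\in T\}$, is an embedding of tense distributive lattices, and if $\mathcal{A}$ is finite then $h_A$ is an isomorphism; (4) the map $k_X:\mathbf{X}\to\mathfrak{M}(\mathfrak{C}(\mathbf{X}))$, $k_X(x)=\{U\in\mathcal{P}_i(X):x\in U\}$, is an embedding of $\mathbf{tDL}$-frames, and if $X$ is finite then $k_X$ is an isomorphism.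
   Context: A tense distributive lattice ($\mathbf{tDL}$-algebra) is a bounded distributive lattice $\langle A,\wedge,\vee,0,1\rangle$ with unary operators $\mathbf{G},\mathbf{H},\mathbf{F},\mathbf{P}$ such that for all $x,y$: $\mathbf{G}1=\mathbf{H}1=1$; $\mathbf{G},\mathbf{H}$ preserve $\wedge$; $x\le\mathbf{G}\mathbf{P}x$, $x\le\mathbf{H}\mathbf{F}x$; $\mathbf{G}(x\vee y)\le\mathbf{G}x\vee\mathbf{F}y$, $\mathbf{H}(x\vee y)\le\mathbf{H}x\vee\mathbf{P}y$; $\mathbf{F}0=\mathbf{P}0=0$; $\mathbf{F},\mathbf{P}$ preserve $\vee$; $\mathbf{P}\mathbf{G}x\le x$, $\mathbf{F}\mathbf{H}x\le x$; $\mathbf{G}x\wedge\mathbf{F}y\le\mathbf{F}(x\wedge y)$, $\mathbf{H}x\wedge\mathbf{P}y\le\mathbf{P}(x\wedge y)$. An embedding of such algebras is an injective homomorphism (preserving lattice operations, bounds and the four operators). For a relation $R$ on $X$: $R(x)=\{y:(x,y)\in R\}$, $R^{-1}(x)=\{y:(y,x)\in R\}$, $R(Y)=\bigcup_{y\in Y}R(y)$, similarly $R^{-1}(Y)$; ${\uparrow},{\downarrow}$ denote up- and down-closures in $(X,\le)$. A $\mathbf{tDL}$-frame is $(X,\le,R)$ with $(X,\le)$ a poset such that for all $x$: (K1) $R({\uparrow}x)\subseteq{\uparrow}R(x)$; (K2) $R^{-1}({\uparrow}x)\subseteq{\uparrow}R^{-1}(x)$; (K3) $R({\downarrow}x)\subseteq{\downarrow}R(x)$;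 (K4) $R^{-1}({\downarrow}x)\subseteq{\downarrow}R^{-1}(x)$; (K5) $R(x)={\uparrow}R(x)\cap{\downarrow}R(x)$. $\mathcal{P}_i(X)$ is the set of up-sets of $(X,\le)$. The complex algebra is $\mathfrak{C}(\mathbf{X})=\langle\mathcal{P}_i(X),\cap,\cup,\emptyset,X,\mathbf{G}_R,\mathbf{H}_{R^{-1}},\mathbf{F}_R,\mathbf{P}_{R^{-1}}\rangle$ with $\mathbf{G}_R(Y)=\{x:R(x)\subseteq Y\}$, $\mathbf{F}_R(Y)=\{x:R(x)\cap Y\ne\emptyset\}$, $\mathbf{H}_{R^{-1}}(Y)=\{x:R^{-1}(x)\subseteq Y\}$, $\mathbf{P}_{R^{-1}}(Y)=\{x:R^{-1}(x)\cap Y\ne\emptyset\}$. The canonical frame of $\mathcal{A}$ is $\mathfrak{M}(\mathcal{A})=(X(A),\subseteq,R_A)$ where $X(A)$ is the set of prime filters of $A$ and $(S,T)\in R_A$ iff $\{a:\mathbf{G}a\in S\}\subseteq T\subseteq\{a:\mathbf{F}a\in S\}$. An embedding of $\mathbf{tDL}$-frames $f:(X,\le,R)\to(X',\le',R')$ is a map with $x\le y\iff f(x)\le' f(y)$ and $(x,y)\in R\iff(f(x),f(y))\in R'$; an isomorphism is a bijective embedding. *)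

theory Defs
  imports "HOL-Algebra.Congruence"
begin

section \<open>Tense distributive lattices\<close>

record 'a tense_algebra = "'a partial_object" +
  tmeet :: "'a \<Rightarrow> 'a \<Rightarrow> 'a"  (infixl \<open>\<sqinter>\<index>\<close> 70)
  tjoin :: "'a \<Rightarrow> 'a \<Rightarrow> 'a"  (infixl \<open>\<squnion>\<index>\<close> 65)
  tbot :: 'a  (\<open>\<bottom>\<index>\<close>)
  ttop :: 'a  (\<open>\<top>\<index>\<close>)
  opG :: "'a \<Rightarrow> 'a"  (\<open>\<^bold>G\<index> _\<close> [81] 80)
  opH :: "'a \<Rightarrow> 'a"  (\<open>\<^bold>H\<index> _\<close> [81] 80)
  opF :: "'a \<Rightarrow> 'a"  (\<open>\<^bold>F\<index> _\<close> [81] 80)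
  opP :: "'a \<Rightarrow> 'a"  (\<open>\<^bold>P\<index> _\<close> [81] 80)

definition tle :: "('a, 'b) tense_algebra_scheme \<Rightarrow> 'a \<Rightarrow> 'a \<Rightarrow> bool"  (infix \<open>\<sqsubseteq>\<index>\<close> 50)
  where "x \<sqsubseteq>\<^bsub>A\<^esub> y \<longleftrightarrow> x \<sqinter>\<^bsub>A\<^esub> y = x"

text \<open>The one-element algebra, with bottom equal to top, is not excluded.\<close>

locale bounded_distributive_lattice =
  fixes A :: "('a, 'b) tense_algebra_scheme" (structure)
  assumes meet_closed: "\<lbrakk>x \<in> carrier A; y \<in> carrier A\<rbrakk> \<Longrightarrow> x \<sqinter> y \<in> carrier A"
    and join_closed: "\<lbrakk>x \<in> carrier A; y \<in> carrier A\<rbrakk> \<Longrightarrow> x \<squnion> y \<in> carrier A"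
    and bot_closed: "\<bottom> \<in> carrier A"
    and top_closed: "\<top> \<in> carrier A"
    and meet_assoc: "\<lbrakk>x \<in> carrier A; y \<in> carrier A; z \<in> carrier A\<rbrakk>
      \<Longrightarrow> (x \<sqinter> y) \<sqinter> z = x \<sqinter> (y \<sqinter> z)"
    and join_assoc: "\<lbrakk>x \<in> carrier A; y \<in> carrier A; z \<in> carrier A\<rbrakk>
      \<Longrightarrow> (x \<squnion> y) \<squnion> z = x \<squnion> (y \<squnion> z)"
    and meet_comm: "\<lbrakk>x \<in> carrier A; y \<in> carrier A\<rbrakk> \<Longrightarrow> x \<sqinter> y = y \<sqinter> x"
    and join_comm: "\<lbrakk>x \<in> carrier A; y \<in> carrier A\<rbrakk> \<Longrightarrow> x \<squnion> y = y \<squnion> x"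
    and meet_join_absorb: "\<lbrakk>x \<in> carrier A; y \<in> carrier A\<rbrakk> \<Longrightarrow> x \<sqinter> (x \<squnion> y) = x"
    and join_meet_absorb: "\<lbrakk>x \<in> carrier A; y \<in> carrier A\<rbrakk> \<Longrightarrow> x \<squnion> (x \<sqinter> y) = x"
    and meet_join_distrib: "\<lbrakk>x \<in> carrier A; y \<in> carrier A; z \<in> carrier A\<rbrakk>
      \<Longrightarrow> x \<sqinter> (y \<squnion> z) = (x \<sqinter> y) \<squnion> (x \<sqinter> z)"
    and bot_least: "x \<in> carrier A \<Longrightarrow> \<bottom> \<sqsubseteq> x"
    and top_greatest: "x \<in> carrier A \<Longrightarrow> x \<sqsubseteq> \<top>"

locale tense_distributive_lattice = bounded_distributive_lattice +
  assumes G_closed: "x \<in> carrier A \<Longrightarrow> \<^bold>G x \<in> carrier A"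
    and H_closed: "x \<in> carrier A \<Longrightarrow> \<^bold>H x \<in> carrier A"
    and F_closed: "x \<in> carrier A \<Longrightarrow> \<^bold>F x \<in> carrier A"
    and P_closed: "x \<in> carrier A \<Longrightarrow> \<^bold>P x \<in> carrier A"
    and G_top: "\<^bold>G \<top> = \<top>"
    and H_top: "\<^bold>H \<top> = \<top>"
    and G_meet: "\<lbrakk>x \<in> carrier A; y \<in> carrier A\<rbrakk> \<Longrightarrow> \<^bold>G (x \<sqinter> y) = \<^bold>G x \<sqinter> \<^bold>G y"
    and H_meet: "\<lbrakk>x \<in> carrier A; y \<in> carrier A\<rbrakk> \<Longrightarrow> \<^bold>H (x \<sqinter> y) = \<^bold>H x \<sqinter> \<^bold>H y"
    and le_G_P: "x \<in> carrier A \<Longrightarrow> x \<sqsubseteq> \<^bold>G (\<^bold>P x)"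
    and le_H_F: "x \<in> carrier A \<Longrightarrow> x \<sqsubseteq> \<^bold>H (\<^bold>F x)"
    and G_join_le: "\<lbrakk>x \<in> carrier A; y \<in> carrier A\<rbrakk> \<Longrightarrow> \<^bold>G (x \<squnion> y) \<sqsubseteq> \<^bold>G x \<squnion> \<^bold>F y"
    and H_join_le: "\<lbrakk>x \<in> carrier A; y \<in> carrier A\<rbrakk> \<Longrightarrow> \<^bold>H (x \<squnion> y) \<sqsubseteq> \<^bold>H x \<squnion> \<^bold>P y"
    and F_bot: "\<^bold>F \<bottom> = \<bottom>"
    and P_bot: "\<^bold>P \<bottom> = \<bottom>"
    and F_join: "\<lbrakk>x \<in> carrier A; y \<in> carrier A\<rbrakk> \<Longrightarrow> \<^bold>F (x \<squnion> y) = \<^bold>F x \<squnion> \<^bold>F y"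
    and P_join: "\<lbrakk>x \<in> carrier A; y \<in> carrier A\<rbrakk> \<Longrightarrow> \<^bold>P (x \<squnion> y) = \<^bold>P x \<squnion> \<^bold>P y"
    and P_G_le: "x \<in> carrier A \<Longrightarrow> \<^bold>P (\<^bold>G x) \<sqsubseteq> x"
    and F_H_le: "x \<in> carrier A \<Longrightarrow> \<^bold>F (\<^bold>H x) \<sqsubseteq> x"
    and G_meet_F_le: "\<lbrakk>x \<in> carrier A; y \<in> carrier A\<rbrakk> \<Longrightarrow> \<^bold>G x \<sqinter> \<^bold>F y \<sqsubseteq> \<^bold>F (x \<sqinter> y)"
    and H_meet_P_le: "\<lbrakk>x \<in> carrier A; y \<in> carrier A\<rbrakk> \<Longrightarrow> \<^bold>H x \<sqinter> \<^bold>P y \<sqsubseteq> \<^bold>P (x \<sqinter> y)"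

definition tense_hom ::
    "('a, 'c) tense_algebra_scheme \<Rightarrow> ('b, 'd) tense_algebra_scheme \<Rightarrow> ('a \<Rightarrow> 'b) set"
  where "tense_hom A B = {h \<in> carrier A \<rightarrow> carrier B.
    (\<forall>x \<in> carrier A. \<forall>y \<in> carrier A. h (x \<sqinter>\<^bsub>A\<^esub> y) = h x \<sqinter>\<^bsub>B\<^esub> h y) \<and>
    (\<forall>x \<in> carrier A. \<forall>y \<in> carrier A. h (x \<squnion>\<^bsub>A\<^esub> y) = h x \<squnion>\<^bsub>B\<^esub> h y) \<and>
    h \<bottom>\<^bsub>A\<^esub> = \<bottom>\<^bsub>B\<^esub> \<and> h \<top>\<^bsub>A\<^esub> = \<top>\<^bsub>B\<^esub> \<and>
    (\<forall>x \<in> carrier A. h (\<^bold>G\<^bsub>A\<^esub> x) = \<^bold>G\<^bsub>B\<^esub> (h x)) \<and>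
    (\<forall>x \<in> carrier A. h (\<^bold>H\<^bsub>A\<^esub> x) = \<^bold>H\<^bsub>B\<^esub> (h x)) \<and>
    (\<forall>x \<in> carrier A. h (\<^bold>F\<^bsub>A\<^esub> x) = \<^bold>F\<^bsub>B\<^esub> (h x)) \<and>
    (\<forall>x \<in> carrier A. h (\<^bold>P\<^bsub>A\<^esub> x) = \<^bold>P\<^bsub>B\<^esub> (h x))}"

definition tense_embedding ::
    "('a, 'c) tense_algebra_scheme \<Rightarrow> ('b, 'd) tense_algebra_scheme \<Rightarrow> ('a \<Rightarrow> 'b) \<Rightarrow> bool"
  where "tense_embedding A B h \<longleftrightarrow> h \<in> tense_hom A B \<and> inj_on h (carrier A)"

definition tense_iso ::
    "('a, 'c) tense_algebra_scheme \<Rightarrow> ('b, 'd) tense_algebra_scheme \<Rightarrow> ('a \<Rightarrow> 'b) \<Rightarrow> bool"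
  where "tense_iso A B h \<longleftrightarrow> h \<in> tense_hom A B \<and> bij_betw h (carrier A) (carrier B)"

definition prime_filter :: "('a, 'b) tense_algebra_scheme \<Rightarrow> 'a set \<Rightarrow> bool"
  where "prime_filter A S \<longleftrightarrow>
    S \<subseteq> carrier A \<and> S \<noteq> {} \<and> S \<noteq> carrier A \<and>
    (\<forall>x \<in> S. \<forall>y \<in> carrier A. x \<sqsubseteq>\<^bsub>A\<^esub> y \<longrightarrow> y \<in> S) \<and>
    (\<forall>x \<in> S. \<forall>y \<in> S. x \<sqinter>\<^bsub>A\<^esub> y \<in> S) \<and>
    (\<forall>x \<in> carrier A. \<forall>y \<in> carrier A. x \<squnion>\<^bsub>A\<^esub> y \<in> S \<longrightarrow> x \<in> S \<or> y \<in> S)"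


section \<open>Frames\<close>

record 'x tense_frame =
  points :: "'x set"
  frame_le :: "'x rel"
  frame_rel :: "'x rel"

text \<open>
  A pair \<open>(x, y) \<in> frame_le X\<close> means \<open>x \<le> y\<close>. Since both relations live on the points,
  the up-closure of \<open>Y\<close> is the relational image \<open>frame_le X `` Y\<close>, its down-closure is
  \<open>(frame_le X)\<inverse> `` Y\<close>, and \<open>R(Y)\<close> is \<open>frame_rel X `` Y\<close>.
\<close>

abbreviation upcl :: "('x, 'b) tense_frame_scheme \<Rightarrow> 'x set \<Rightarrow> 'x set"
  where "upcl X Y \<equiv> frame_le X `` Y"

abbreviation downcl :: "('x, 'b) tense_frame_scheme \<Rightarrow> 'x set \<Rightarrow> 'x set"
  where "downcl X Y \<equiv> (frame_le X)\<inverse> `` Y"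

abbreviation R_im :: "('x, 'b) tense_frame_scheme \<Rightarrow> 'x set \<Rightarrow> 'x set"
  where "R_im X Y \<equiv> frame_rel X `` Y"

abbreviation R_inv_im :: "('x, 'b) tense_frame_scheme \<Rightarrow> 'x set \<Rightarrow> 'x set"
  where "R_inv_im X Y \<equiv> (frame_rel X)\<inverse> `` Y"

locale tDL_frame =
  fixes X :: "('x, 'b) tense_frame_scheme"
  assumes poset: "partial_order_on (points X) (frame_le X)"
    and rel_on_points: "frame_rel X \<subseteq> points X \<times> points X"
    and K1: "x \<in> points X \<Longrightarrow> R_im X (upcl X {x}) \<subseteq> upcl X (R_im X {x})"
    and K2: "x \<in> points X \<Longrightarrow> R_inv_im X (upcl X {x}) \<subseteq> upcl X (R_inv_im X {x})"
    and K3: "x \<in> points X \<Longrightarrow> R_im X (downcl X {x}) \<subseteq> downcl X (R_im X {x})"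
    and K4: "x \<in> points X \<Longrightarrow> R_inv_im X (downcl X {x}) \<subseteq> downcl X (R_inv_im X {x})"
    and K5: "x \<in> points X \<Longrightarrow> R_im X {x} = upcl X (R_im X {x}) \<inter> downcl X (R_im X {x})"

definition frame_embedding ::
    "('x, 'b) tense_frame_scheme \<Rightarrow> ('y, 'c) tense_frame_scheme \<Rightarrow> ('x \<Rightarrow> 'y) \<Rightarrow> bool"
  where "frame_embedding X Y f \<longleftrightarrow> f \<in> points X \<rightarrow> points Y \<and>
    (\<forall>x \<in> points X. \<forall>y \<in> points X. (x, y) \<in> frame_le X \<longleftrightarrow> (f x, f y) \<in> frame_le Y) \<and>
    (\<forall>x \<in> points X. \<forall>y \<in> points X. (x, y) \<in> frame_rel X \<longleftrightarrow> (f x, f y) \<in> frame_rel Y)"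

definition frame_iso ::
    "('x, 'b) tense_frame_scheme \<Rightarrow> ('y, 'c) tense_frame_scheme \<Rightarrow> ('x \<Rightarrow> 'y) \<Rightarrow> bool"
  where "frame_iso X Y f \<longleftrightarrow> frame_embedding X Y f \<and> bij_betw f (points X) (points Y)"


section \<open>Complex algebras and canonical frames\<close>

definition upsets :: "('x, 'b) tense_frame_scheme \<Rightarrow> 'x set set"
  where "upsets X = {Y. Y \<subseteq> points X \<and> (\<forall>x \<in> Y. \<forall>y. (x, y) \<in> frame_le X \<longrightarrow> y \<in> Y)}"

definition complex_algebra :: "('x, 'b) tense_frame_scheme \<Rightarrow> 'x set tense_algebra"
  where "complex_algebra X =
    \<lparr>carrier = upsets X,
     tmeet = (\<inter>), tjoin = (\<union>), tbot = {}, ttop = points X,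
     opG = (\<lambda>Y. {x \<in> points X. R_im X {x} \<subseteq> Y}),
     opH = (\<lambda>Y. {x \<in> points X. R_inv_im X {x} \<subseteq> Y}),
     opF = (\<lambda>Y. {x \<in> points X. R_im X {x} \<inter> Y \<noteq> {}}),
     opP = (\<lambda>Y. {x \<in> points X. R_inv_im X {x} \<inter> Y \<noteq> {}})\<rparr>"

definition prime_filters :: "('a, 'b) tense_algebra_scheme \<Rightarrow> 'a set set"
  where "prime_filters A = {S. prime_filter A S}"

definition canonical_frame :: "('a, 'b) tense_algebra_scheme \<Rightarrow> 'a set tense_frame"
  where "canonical_frame A =
    \<lparr>points = prime_filters A,
     frame_le = {(S, T). S \<in> prime_filters A \<and> T \<in> prime_filters A \<and> S \<subseteq> T},
     frame_rel = {(S, T). S \<in> prime_filters A \<and> T \<in> prime_filters A \<and>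
       {a \<in> carrier A. \<^bold>G\<^bsub>A\<^esub> a \<in> S} \<subseteq> T \<and> T \<subseteq> {a \<in> carrier A. \<^bold>F\<^bsub>A\<^esub> a \<in> S}}\<rparr>"

definition rep_algebra :: "('a, 'b) tense_algebra_scheme \<Rightarrow> 'a \<Rightarrow> 'a set set"
  where "rep_algebra A a = {T \<in> prime_filters A. a \<in> T}"

definition rep_frame :: "('x, 'b) tense_frame_scheme \<Rightarrow> 'x \<Rightarrow> 'x set set"
  where "rep_frame X x = {U \<in> upsets X. x \<in> U}"

end

theory Submission
  imports Defs
begin

text \<open>
  Everything rests on the prime filter theorem. For a prime filter \<open>S\<close>, the set of \<open>a\<close> with
  \<open>G a \<in> S\<close> is a filter and the set of \<open>a\<close> with \<open>F a \<notin> S\<close> is an ideal; enlarging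
  the ideal by elements \<open>j\<close> with \<open>G j \<notin> S\<close>, or the filter by elements \<open>u\<close> with
  \<open>F u \<in> S\<close>, keeps them disjoint by \<open>G (x \<or> y) \<le> G x \<or> F y\<close> and
  \<open>G x \<and> F y \<le> F (x \<and> y)\<close>. Hence there are successors \<open>T\<close> of \<open>S\<close>
  avoiding a given ideal or containing a given filter. This yields (K1), (K3) and the
  preservation of \<open>G\<close> and \<open>F\<close>. Reversing time, i.e. exchanging \<open>G\<close> with \<open>H\<close> and \<open>F\<close> with \<open>P\<close>,
  converts the canonical relation into its converse by the adjunctions, so the remaining
  half follows by duality.
\<close>

section \<open>Filters and ideals\<close>

definition lattice_filter :: "('a, 'b) tense_algebra_scheme \<Rightarrow> 'a set \<Rightarrow> bool"
  where "lattice_filter A S \<longleftrightarrow> S \<subseteq> carrier A \<and> S \<noteq> {} \<and>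
    (\<forall>x \<in> S. \<forall>y \<in> carrier A. x \<sqsubseteq>\<^bsub>A\<^esub> y \<longrightarrow> y \<in> S) \<and>
    (\<forall>x \<in> S. \<forall>y \<in> S. x \<sqinter>\<^bsub>A\<^esub> y \<in> S)"

definition lattice_ideal :: "('a, 'b) tense_algebra_scheme \<Rightarrow> 'a set \<Rightarrow> bool"
  where "lattice_ideal A J \<longleftrightarrow> J \<subseteq> carrier A \<and> J \<noteq> {} \<and>
    (\<forall>x \<in> J. \<forall>y \<in> carrier A. y \<sqsubseteq>\<^bsub>A\<^esub> x \<longrightarrow> y \<in> J) \<and>
    (\<forall>x \<in> J. \<forall>y \<in> J. x \<squnion>\<^bsub>A\<^esub> y \<in> J)"

lemma lattice_filterI:
  assumes "S \<subseteq> carrier A" "S \<noteq> {}"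
    and "\<And>x y. \<lbrakk>x \<in> S; y \<in> carrier A; x \<sqsubseteq>\<^bsub>A\<^esub> y\<rbrakk> \<Longrightarrow> y \<in> S"
    and "\<And>x y. \<lbrakk>x \<in> S; y \<in> S\<rbrakk> \<Longrightarrow> x \<sqinter>\<^bsub>A\<^esub> y \<in> S"
  shows "lattice_filter A S"
  using assms unfolding lattice_filter_def by blast

lemma lattice_filterD:
  assumes "lattice_filter A S"
  shows "S \<subseteq> carrier A" "S \<noteq> {}"
    and "\<And>x y. \<lbrakk>x \<in> S; y \<in> carrier A; x \<sqsubseteq>\<^bsub>A\<^esub> y\<rbrakk> \<Longrightarrow> y \<in> S"
    and "\<And>x y. \<lbrakk>x \<in> S; y \<in> S\<rbrakk> \<Longrightarrow> x \<sqinter>\<^bsub>A\<^esub> y \<in> S"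
  using assms unfolding lattice_filter_def by blast+

lemma lattice_idealI:
  assumes "J \<subseteq> carrier A" "J \<noteq> {}"
    and "\<And>x y. \<lbrakk>x \<in> J; y \<in> carrier A; y \<sqsubseteq>\<^bsub>A\<^esub> x\<rbrakk> \<Longrightarrow> y \<in> J"
    and "\<And>x y. \<lbrakk>x \<in> J; y \<in> J\<rbrakk> \<Longrightarrow> x \<squnion>\<^bsub>A\<^esub> y \<in> J"
  shows "lattice_ideal A J"
  using assms unfolding lattice_ideal_def by blast

lemma lattice_idealD:
  assumes "lattice_ideal A J"
  shows "J \<subseteq> carrier A" "J \<noteq> {}"
    and "\<And>x y. \<lbrakk>x \<in> J; y \<in> carrier A; y \<sqsubseteq>\<^bsub>A\<^esub> x\<rbrakk> \<Longrightarrow> y \<in> J"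
    and "\<And>x y. \<lbrakk>x \<in> J; y \<in> J\<rbrakk> \<Longrightarrow> x \<squnion>\<^bsub>A\<^esub> y \<in> J"
  using assms unfolding lattice_ideal_def by blast+

lemma prime_filter_iff:
  "prime_filter A S \<longleftrightarrow> lattice_filter A S \<and> S \<noteq> carrier A \<and>
    (\<forall>x \<in> carrier A. \<forall>y \<in> carrier A. x \<squnion>\<^bsub>A\<^esub> y \<in> S \<longrightarrow> x \<in> S \<or> y \<in> S)"
  unfolding prime_filter_def lattice_filter_def by blast

text \<open>Provides the upper bounds for Zorn's lemma: comparability puts any two elements of the
  union into one member of the chain, which already contains their meet.\<close>

lemma lattice_filter_Union_chain:
  assumes "C \<noteq> {}" "\<And>S. S \<in> C \<Longrightarrow> lattice_filter A S"
    and "\<And>S T. \<lbrakk>S \<in> C; T \<in> C\<rbrakk> \<Longrightarrow> S \<subseteq> T \<or> T \<subseteq> S"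
  shows "lattice_filter A (\<Union>C)"
proof (rule lattice_filterI)
  show "\<Union>C \<subseteq> carrier A"
    using assms(2) lattice_filterD(1) by blast
  show "\<Union>C \<noteq> {}"
    using assms(1,2) lattice_filterD(2) by blast
  show "y \<in> \<Union>C" if "x \<in> \<Union>C" "y \<in> carrier A" "x \<sqsubseteq>\<^bsub>A\<^esub> y" for x y
  proof -
    obtain S where "S \<in> C" "x \<in> S" using \<open>x \<in> \<Union>C\<close> by blast
    then show ?thesis using lattice_filterD(3)[OF assms(2)] that(2,3) by blast
  qed
  fix x y assume "x \<in> \<Union>C" "y \<in> \<Union>C"
  then obtain S T where "S \<in> C" "T \<in> C" "x \<in> S" "y \<in> T" by blast
  then obtain U where "U \<in> C" "x \<in> U" "y \<in> U"
    using assms(3) by blast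
  then show "x \<sqinter>\<^bsub>A\<^esub> y \<in> \<Union>C"
    using lattice_filterD(4)[OF assms(2)] by blast
qed

section \<open>Order calculus, generated filters and prime filters in a bounded distributive
  lattice\<close>

context bounded_distributive_lattice
begin

text \<open>Idempotence of meet from two absorptions: x \<sqinter> x = x \<sqinter> (x \<squnion> (x
  \<sqinter> y)) = x.\<close>

lemma le_refl: "x \<in> carrier A \<Longrightarrow> x \<sqsubseteq> x"
  unfolding tle_def by (metis bot_closed join_meet_absorb meet_closed meet_join_absorb)

lemma le_antisym: "\<lbrakk>x \<in> carrier A; y \<in> carrier A; x \<sqsubseteq> y; y \<sqsubseteq> x\<rbrakk> \<Longrightarrow> x = y"
  unfolding tle_def by (metis meet_comm)

lemma le_trans:
  "\<lbrakk>x \<in> carrier A; y \<in> carrier A; z \<in> carrier A; x \<sqsubseteq> y; y \<sqsubseteq> z\<rbrakk> \<Longrightarrow> x \<sqsubseteq> z"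
  unfolding tle_def by (metis meet_assoc)

lemma le_iff_join: "\<lbrakk>x \<in> carrier A; y \<in> carrier A\<rbrakk> \<Longrightarrow> x \<sqsubseteq> y \<longleftrightarrow> x \<squnion> y = y"
  unfolding tle_def by (metis join_comm join_meet_absorb meet_comm meet_join_absorb)

lemma meet_le1: "\<lbrakk>x \<in> carrier A; y \<in> carrier A\<rbrakk> \<Longrightarrow> x \<sqinter> y \<sqsubseteq> x"
  by (metis join_comm join_meet_absorb le_iff_join meet_closed)

lemma meet_le2: "\<lbrakk>x \<in> carrier A; y \<in> carrier A\<rbrakk> \<Longrightarrow> x \<sqinter> y \<sqsubseteq> y"
  by (metis meet_le1 meet_comm)

lemma meet_greatest:
  "\<lbrakk>x \<in> carrier A; y \<in> carrier A; z \<in> carrier A; z \<sqsubseteq> x; z \<sqsubseteq> y\<rbrakk> \<Longrightarrow> z \<sqsubseteq> x \<sqinter> y"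
  unfolding tle_def by (metis meet_assoc)

lemma join_ge1: "\<lbrakk>x \<in> carrier A; y \<in> carrier A\<rbrakk> \<Longrightarrow> x \<sqsubseteq> x \<squnion> y"
  unfolding tle_def by (rule meet_join_absorb)

lemma join_ge2: "\<lbrakk>x \<in> carrier A; y \<in> carrier A\<rbrakk> \<Longrightarrow> y \<sqsubseteq> x \<squnion> y"
  by (metis join_ge1 join_comm)

lemma join_least:
  "\<lbrakk>x \<in> carrier A; y \<in> carrier A; z \<in> carrier A; x \<sqsubseteq> z; y \<sqsubseteq> z\<rbrakk> \<Longrightarrow> x \<squnion> y \<sqsubseteq> z"
  by (metis join_assoc join_closed le_iff_join)

lemma meet_mono:
  assumes "x \<in> carrier A" "y \<in> carrier A" "x' \<in> carrier A" "y' \<in> carrier A"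
    and "x \<sqsubseteq> x'" "y \<sqsubseteq> y'"
  shows "x \<sqinter> y \<sqsubseteq> x' \<sqinter> y'"
  using assms by (meson le_trans meet_closed meet_greatest meet_le1 meet_le2)

lemma join_mono:
  assumes "x \<in> carrier A" "y \<in> carrier A" "x' \<in> carrier A" "y' \<in> carrier A"
    and "x \<sqsubseteq> x'" "y \<sqsubseteq> y'"
  shows "x \<squnion> y \<sqsubseteq> x' \<squnion> y'"
  using assms by (meson le_trans join_closed join_least join_ge1 join_ge2)

text \<open>Regroups two witnesses \<open>s \<sqinter> t\<close> and \<open>s' \<sqinter> t'\<close>
  by the filter they come from, as closure of \<open>filter_join\<close> under meets
  requires.\<close>

lemma meet_interchange:
  assumes "a \<in> carrier A" "b \<in> carrier A" "c \<in> carrier A" "d \<in> carrier A"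
  shows "(a \<sqinter> b) \<sqinter> (c \<sqinter> d) = (a \<sqinter> c) \<sqinter> (b \<sqinter> d)"
  using assms by (metis meet_assoc meet_closed meet_comm)

lemma join_interchange:
  assumes "a \<in> carrier A" "b \<in> carrier A" "c \<in> carrier A" "d \<in> carrier A"
  shows "(a \<squnion> b) \<squnion> (c \<squnion> d) = (a \<squnion> c) \<squnion> (b \<squnion> d)"
  using assms by (metis join_assoc join_closed join_comm)

lemma filter_top: "lattice_filter A S \<Longrightarrow> \<top> \<in> S"
  using lattice_filterD[of A S] top_greatest top_closed by blast

lemma ideal_bot: "lattice_ideal A J \<Longrightarrow> \<bottom> \<in> J"
  using lattice_idealD[of A J] bot_least bot_closed by blast

lemma principal_filter: "a \<in> carrier A \<Longrightarrow> lattice_filter A {x \<in> carrier A. a \<sqsubseteq> x}"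
  by (rule lattice_filterI) (auto intro: le_refl le_trans meet_greatest meet_closed)

lemma principal_ideal: "a \<in> carrier A \<Longrightarrow> lattice_ideal A {x \<in> carrier A. x \<sqsubseteq> a}"
  by (rule lattice_idealI) (auto intro: le_refl le_trans join_least join_closed)

text \<open>\<open>U\<close> is the filter generated by \<open>S\<close> and \<open>T\<close>
  together. It contains \<open>S\<close> because \<top> lies in \<open>T\<close>, and
  \<open>T\<close> because \<top> lies in \<open>S\<close>.\<close>

lemma filter_join:
  assumes S: "lattice_filter A S" and T: "lattice_filter A T"
  defines "U \<equiv> {z \<in> carrier A. \<exists>s \<in> S. \<exists>t \<in> T. s \<sqinter> t \<sqsubseteq> z}"
  shows "lattice_filter A U" "S \<subseteq> U" "T \<subseteq> U"
proof -
  note SD = lattice_filterD[OF S] and TD = lattice_filterD[OF T]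
  show sub: "S \<subseteq> U"
    using SD(1) meet_le1[OF _ top_closed] filter_top[OF T] unfolding U_def by blast
  show "T \<subseteq> U"
    using TD(1) meet_le2[OF top_closed] filter_top[OF S] unfolding U_def by blast
  show "lattice_filter A U"
  proof (rule lattice_filterI)
    show "U \<subseteq> carrier A" unfolding U_def by blast
    show "U \<noteq> {}" using sub SD(2) by blast
    show "y \<in> U" if "x \<in> U" "y \<in> carrier A" "x \<sqsubseteq> y" for x y
    proof -
      obtain s t where st: "s \<in> S" "t \<in> T" "s \<sqinter> t \<sqsubseteq> x" "x \<in> carrier A"
        using \<open>x \<in> U\<close> unfolding U_def by blast
      then have "s \<sqinter> t \<sqsubseteq> y"
        using le_trans[of "s \<sqinter> t" x y] that meet_closed SD(1) TD(1) by blast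
      then show ?thesis using st that unfolding U_def by blast
    qed
    show "x \<sqinter> y \<in> U" if "x \<in> U" "y \<in> U" for x y
    proof -
      obtain s t where st: "s \<in> S" "t \<in> T" "s \<sqinter> t \<sqsubseteq> x" "x \<in> carrier A"
        using \<open>x \<in> U\<close> unfolding U_def by blast
      obtain s' t' where st': "s' \<in> S" "t' \<in> T" "s' \<sqinter> t' \<sqsubseteq> y" "y \<in> carrier A"
        using \<open>y \<in> U\<close> unfolding U_def by blast
      have c: "s \<in> carrier A" "t \<in> carrier A" "s' \<in> carrier A" "t' \<in> carrier A"
        using st st' SD(1) TD(1) by blast+
      have "(s \<sqinter> s') \<sqinter> (t \<sqinter> t') \<sqsubseteq> x \<sqinter> y"
        using meet_mono[of "s \<sqinter> t" "s' \<sqinter> t'" x y] st st' c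
        by (simp add: meet_closed meet_interchange)
      then show ?thesis
        using SD(4)[OF st(1) st'(1)] TD(4)[OF st(2) st'(2)] meet_closed[OF st(4) st'(4)]
        unfolding U_def by blast
    qed
  qed
qed

text \<open>The order dual of \<open>filter_join\<close>, with \<bottom> in the role of
  \<top>.\<close>

lemma ideal_join:
  assumes I: "lattice_ideal A I" and J: "lattice_ideal A J"
  defines "K \<equiv> {z \<in> carrier A. \<exists>i \<in> I. \<exists>j \<in> J. z \<sqsubseteq> i \<squnion> j}"
  shows "lattice_ideal A K" "I \<subseteq> K" "J \<subseteq> K"
proof -
  note ID = lattice_idealD[OF I] and JD = lattice_idealD[OF J]
  show sub: "I \<subseteq> K"
    using ID(1) join_ge1[OF _ bot_closed] ideal_bot[OF J] unfolding K_def by blast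
  show "J \<subseteq> K"
    using JD(1) join_ge2[OF bot_closed] ideal_bot[OF I] unfolding K_def by blast
  show "lattice_ideal A K"
  proof (rule lattice_idealI)
    show "K \<subseteq> carrier A" unfolding K_def by blast
    show "K \<noteq> {}" using sub ID(2) by blast
    show "y \<in> K" if "x \<in> K" "y \<in> carrier A" "y \<sqsubseteq> x" for x y
    proof -
      obtain i j where ij: "i \<in> I" "j \<in> J" "x \<sqsubseteq> i \<squnion> j" "x \<in> carrier A"
        using \<open>x \<in> K\<close> unfolding K_def by blast
      then have "y \<sqsubseteq> i \<squnion> j"
        using le_trans[of y x "i \<squnion> j"] that join_closed ID(1) JD(1) by blast
      then show ?thesis using ij that unfolding K_def by blast
    qed
    show "x \<squnion> y \<in> K" if "x \<in> K" "y \<in> K" for x y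
    proof -
      obtain i j where ij: "i \<in> I" "j \<in> J" "x \<sqsubseteq> i \<squnion> j" "x \<in> carrier A"
        using \<open>x \<in> K\<close> unfolding K_def by blast
      obtain i' j' where ij': "i' \<in> I" "j' \<in> J" "y \<sqsubseteq> i' \<squnion> j'" "y \<in> carrier A"
        using \<open>y \<in> K\<close> unfolding K_def by blast
      have c: "i \<in> carrier A" "j \<in> carrier A" "i' \<in> carrier A" "j' \<in> carrier A"
        using ij ij' ID(1) JD(1) by blast+
      have "x \<squnion> y \<sqsubseteq> (i \<squnion> i') \<squnion> (j \<squnion> j')"
        using join_mono[of x y "i \<squnion> j" "i' \<squnion> j'"] ij ij' c
        by (simp add: join_closed join_interchange)
      then show ?thesis
        using ID(4)[OF ij(1) ij'(1)] JD(4)[OF ij(2) ij'(2)] join_closed[OF ij(4) ij'(4)]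
        unfolding K_def by blast
    qed
  qed
qed

text \<open>If \<open>x\<close> is outside \<open>M\<close>, the filter generated by
  \<open>M\<close> and \<open>x\<close> meets \<open>J\<close> by maximality, so
  \<open>m \<sqinter> x\<close> is in \<open>J\<close> for some \<open>m\<close> in
  \<open>M\<close>. If \<open>x\<close> and \<open>y\<close> are both outside, with witnesses
  \<open>m\<close> and \<open>n\<close>, distributivity puts
  \<open>(m \<sqinter> n) \<sqinter> (x \<squnion> y)\<close> into \<open>J\<close>, while
  \<open>x \<squnion> y\<close> in \<open>M\<close> would put it into \<open>M\<close>.\<close>

lemma maximal_filter_prime:
  assumes M: "lattice_filter A M" and J: "lattice_ideal A J" and MJ: "M \<inter> J = {}"
    and max: "\<And>U. \<lbrakk>lattice_filter A U; M \<subseteq> U; U \<inter> J = {}\<rbrakk> \<Longrightarrow> U = M"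
  shows "prime_filter A M"
proof -
  note MD = lattice_filterD[OF M] and JD = lattice_idealD[OF J]
  have meets_ideal: "\<exists>m \<in> M. m \<sqinter> x \<in> J" if x: "x \<in> carrier A" "x \<notin> M" for x
  proof -
    let ?U = "{z \<in> carrier A. \<exists>m \<in> M. \<exists>t \<in> {y \<in> carrier A. x \<sqsubseteq> y}. m \<sqinter> t \<sqsubseteq> z}"
    note U = filter_join[OF M principal_filter[OF x(1)]]
    have "x \<in> ?U" using U(3) x(1) le_refl[OF x(1)] by blast
    then have "?U \<inter> J \<noteq> {}" using max[OF U(1,2)] x(2) by blast
    then obtain m t z where mt: "m \<in> M" "t \<in> carrier A" "x \<sqsubseteq> t" "m \<sqinter> t \<sqsubseteq> z" "z \<in> J"
      by blast
    then have c: "m \<in> carrier A" "z \<in> carrier A" using MD(1) JD(1) by blast+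
    have "m \<sqinter> x \<sqsubseteq> z"
      by (rule le_trans[of _ "m \<sqinter> t"]) (simp_all add: mt c x le_refl meet_closed meet_mono)
    then have "m \<sqinter> x \<in> J"
      using JD(3)[OF mt(5)] c x by (simp add: meet_closed)
    then show ?thesis using mt(1) by blast
  qed
  have "x \<in> M \<or> y \<in> M" if xy: "x \<in> carrier A" "y \<in> carrier A" "x \<squnion> y \<in> M" for x y
  proof (rule ccontr)
    assume "\<not> (x \<in> M \<or> y \<in> M)"
    then obtain m n where mn: "m \<in> M" "m \<sqinter> x \<in> J" "n \<in> M" "n \<sqinter> y \<in> J"
      using meets_ideal xy by blast
    then have c: "m \<in> carrier A" "n \<in> carrier A" "m \<sqinter> n \<in> carrier A"
      using MD(1) meet_closed by blast+
    have "(m \<sqinter> n) \<sqinter> x \<sqsubseteq> m \<sqinter> x" "(m \<sqinter> n) \<sqinter> y \<sqsubseteq> n \<sqinter> y"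
      using c xy by (simp_all add: meet_mono meet_le1 meet_le2 le_refl)
    then have "(m \<sqinter> n) \<sqinter> x \<in> J" "(m \<sqinter> n) \<sqinter> y \<in> J"
      using JD(3)[OF mn(2)] JD(3)[OF mn(4)] c xy by (simp_all add: meet_closed)
    then have "(m \<sqinter> n) \<sqinter> (x \<squnion> y) \<in> J"
      using JD(4) c xy by (simp add: meet_join_distrib)
    moreover have "(m \<sqinter> n) \<sqinter> (x \<squnion> y) \<in> M"
      using MD(4) mn xy by blast
    ultimately show False using MJ by blast
  qed
  moreover have "M \<noteq> carrier A" using MJ JD(1,2) by blast
  ultimately show ?thesis using M unfolding prime_filter_iff by blast
qed

text \<open>Zorn's lemma applied to the filters that extend \<open>S\<close> and avoid
  \<open>J\<close>; a maximal one is prime by \<open>maximal_filter_prime\<close>.\<close>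

theorem prime_filter_separation:
  assumes S: "lattice_filter A S" and J: "lattice_ideal A J" and SJ: "S \<inter> J = {}"
  obtains T where "prime_filter A T" "S \<subseteq> T" "T \<inter> J = {}"
proof -
  let ?Z = "{U. lattice_filter A U \<and> S \<subseteq> U \<and> U \<inter> J = {}}"
  have "\<exists>M \<in> ?Z. \<forall>U \<in> ?Z. M \<subseteq> U \<longrightarrow> U = M"
  proof (rule subset_Zorn_nonempty)
    show "?Z \<noteq> {}" using S SJ by blast
    fix C assume C: "C \<noteq> {}" "subset.chain ?Z C"
    have "lattice_filter A (\<Union>C)"
      by (rule lattice_filter_Union_chain) (use C in \<open>auto simp: subset_chain_def\<close>)
    then show "\<Union>C \<in> ?Z"
      using C unfolding subset_chain_def by blast
  qed
  then obtain M where "M \<in> ?Z" and "\<forall>U \<in> ?Z. M \<subseteq> U \<longrightarrow> U = M" by blast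
  then show ?thesis
    using that[of M] maximal_filter_prime[OF _ J, of M] by blast
qed

lemma prime_filterD:
  assumes "prime_filter A S"
  shows "lattice_filter A S" "\<bottom> \<notin> S"
    and "\<And>x y. \<lbrakk>x \<in> carrier A; y \<in> carrier A; x \<squnion> y \<in> S\<rbrakk> \<Longrightarrow> x \<in> S \<or> y \<in> S"
proof -
  show S: "lattice_filter A S" using assms unfolding prime_filter_iff by blast
  show "\<bottom> \<notin> S"
  proof
    assume "\<bottom> \<in> S"
    then have "carrier A \<subseteq> S"
      using lattice_filterD(3)[OF S] bot_least by blast
    then show False
      using assms lattice_filterD(1)[OF S] unfolding prime_filter_iff by simp
  qed
qed (use assms in \<open>auto simp: prime_filter_iff\<close>)

lemma prime_filter_mono:
  assumes "prime_filter A S" "x \<in> S" "y \<in> carrier A" "x \<sqsubseteq> y"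
  shows "y \<in> S"
  by (rule lattice_filterD(3)[OF prime_filterD(1)[OF assms(1)] assms(2-4)])

lemma prime_filter_subset: "prime_filter A S \<Longrightarrow> S \<subseteq> carrier A"
  by (rule lattice_filterD(1)[OF prime_filterD(1)])

lemma prime_filter_join_iff:
  assumes "prime_filter A S" "x \<in> carrier A" "y \<in> carrier A"
  shows "x \<squnion> y \<in> S \<longleftrightarrow> x \<in> S \<or> y \<in> S"
  using assms by (metis prime_filterD(3) prime_filter_mono join_closed join_ge1 join_ge2)

lemma prime_filter_meet_iff:
  assumes "prime_filter A S" "x \<in> carrier A" "y \<in> carrier A"
  shows "x \<sqinter> y \<in> S \<longleftrightarrow> x \<in> S \<and> y \<in> S"
  using assms
  by (metis prime_filterD(1) lattice_filterD(4) prime_filter_mono meet_closed meet_le1 meet_le2)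

text \<open>Turns an upper bound into an avoidance condition: a filter is contained in
  \<open>S\<close> iff it avoids this ideal.\<close>

lemma prime_filter_complement_ideal:
  assumes "prime_filter A S"
  shows "lattice_ideal A (carrier A - S)"
proof (rule lattice_idealI)
  show "carrier A - S \<noteq> {}" using prime_filterD(2)[OF assms] bot_closed by blast
  show "y \<in> carrier A - S" if "x \<in> carrier A - S" "y \<in> carrier A" "y \<sqsubseteq> x" for x y
    using that prime_filter_mono[OF assms, of y x] by blast
  show "x \<squnion> y \<in> carrier A - S" if "x \<in> carrier A - S" "y \<in> carrier A - S" for x y
    using that prime_filterD(3)[OF assms, of x y] join_closed[of x y] by blast
qed blast

text \<open>Used with \<open>W = S\<close>, where it says that a finite filter has a least element;
  both finite surjectivity proofs start from it.\<close>

lemma finite_filter_lower_bound: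
  assumes "lattice_filter A S" "finite W" "W \<subseteq> S"
  obtains a where "a \<in> S" "\<And>w. w \<in> W \<Longrightarrow> a \<sqsubseteq> w"
proof -
  have "\<exists>a \<in> S. \<forall>w \<in> W. a \<sqsubseteq> w"
    using assms(2,3)
  proof (induction W)
    case empty
    then show ?case using lattice_filterD(2)[OF assms(1)] by blast
  next
    case (insert w W)
    then obtain a where a: "a \<in> S" "\<forall>w \<in> W. a \<sqsubseteq> w" by blast
    note SD = lattice_filterD[OF assms(1)]
    have c: "a \<in> carrier A" "w \<in> carrier A" "a \<sqinter> w \<in> S" "a \<sqinter> w \<in> carrier A"
      using a insert.prems SD(1,4) by blast+
    have "a \<sqinter> w \<sqsubseteq> v" if "v \<in> W" for v
      using le_trans[of "a \<sqinter> w" a v] meet_le1[of a w] a(2) c that insert.prems SD(1)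
      by (meson subset_iff insert_subset)
    then show ?case using c meet_le2[of a w] by blast
  qed
  then show ?thesis using that by blast
qed

text \<open>The up-set of \<open>a\<close> and the down-set of \<open>b\<close> are disjoint by
  transitivity, so they can be separated. This is what makes the representation map
  injective.\<close>

lemma prime_filters_separate:
  assumes "a \<in> carrier A" "b \<in> carrier A" "\<not> a \<sqsubseteq> b"
  obtains T where "prime_filter A T" "a \<in> T" "b \<notin> T"
proof -
  have "{x \<in> carrier A. a \<sqsubseteq> x} \<inter> {x \<in> carrier A. x \<sqsubseteq> b} = {}"
    using assms le_trans[of a _ b] by blast
  then obtain T where "prime_filter A T" "{x \<in> carrier A. a \<sqsubseteq> x} \<subseteq> T"
    "T \<inter> {x \<in> carrier A. x \<sqsubseteq> b} = {}"
    using prime_filter_separation[OF principal_filter[OF assms(1)] principal_ideal[OF assms(2)]]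
    by blast
  moreover have "a \<in> {x \<in> carrier A. a \<sqsubseteq> x}" "b \<in> {x \<in> carrier A. x \<sqsubseteq> b}"
    using assms le_refl by simp_all
  ultimately show ?thesis using that by blast
qed

end

section \<open>Time reversal\<close>

definition reverse_algebra :: "('a, 'b) tense_algebra_scheme \<Rightarrow> ('a, 'b) tense_algebra_scheme"
  where "reverse_algebra A = A\<lparr>opG := opH A, opH := opG A, opF := opP A, opP := opF A\<rparr>"

definition reverse_frame :: "('x, 'b) tense_frame_scheme \<Rightarrow> ('x, 'b) tense_frame_scheme"
  where "reverse_frame X = X\<lparr>frame_rel := (frame_rel X)\<inverse>\<rparr>"

lemma reverse_algebra_simps [simp]:
  "carrier (reverse_algebra A) = carrier A"
  "tmeet (reverse_algebra A) = tmeet A" "tjoin (reverse_algebra A) = tjoin A"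
  "tbot (reverse_algebra A) = tbot A" "ttop (reverse_algebra A) = ttop A"
  "opG (reverse_algebra A) = opH A" "opH (reverse_algebra A) = opG A"
  "opF (reverse_algebra A) = opP A" "opP (reverse_algebra A) = opF A"
  "tle (reverse_algebra A) = tle A"
  by (auto simp: reverse_algebra_def tle_def fun_eq_iff)

lemma reverse_frame_simps [simp]:
  "points (reverse_frame X) = points X" "frame_le (reverse_frame X) = frame_le X"
  "frame_rel (reverse_frame X) = (frame_rel X)\<inverse>"
  by (auto simp: reverse_frame_def)

lemma prime_filter_reverse [simp]: "prime_filter (reverse_algebra A) = prime_filter A"
  by (simp add: prime_filter_def fun_eq_iff)

lemma prime_filters_reverse [simp]: "prime_filters (reverse_algebra A) = prime_filters A"
  by (simp add: prime_filters_def)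

lemma upsets_reverse [simp]: "upsets (reverse_frame X) = upsets X"
  by (simp add: upsets_def)

text \<open>Purely definitional, in contrast to \<open>canonical_frame_reverse\<close>, which rests
  on the adjunction inequalities.\<close>

lemma complex_algebra_reverse:
  "complex_algebra (reverse_frame X) = reverse_algebra (complex_algebra X)"
  by (simp add: complex_algebra_def reverse_algebra_def)

text \<open>Time reversal permutes the axioms: after unfolding, every goal is again an axiom of
  \<open>A\<close>.\<close>

lemma tense_distributive_lattice_reverse:
  assumes "tense_distributive_lattice A"
  shows "tense_distributive_lattice (reverse_algebra A)"
proof -
  interpret tense_distributive_lattice A by fact
  show ?thesis
    by (unfold_locales; unfold reverse_algebra_simps;
      (rule meet_closed join_closed bot_closed top_closed meet_assoc join_assoc meet_comm join_comm
        meet_join_absorb join_meet_absorb meet_join_distrib bot_least top_greatest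
        G_closed H_closed F_closed P_closed G_top H_top G_meet H_meet le_G_P le_H_F G_join_le
        H_join_le F_bot P_bot F_join P_join P_G_le F_H_le G_meet_F_le H_meet_P_le; assumption))
qed

section \<open>Existence of successors in the canonical relation, and its converse\<close>

context tense_distributive_lattice
begin

lemma le_G: assumes "x \<in> carrier A" "y \<in> carrier A" "x \<sqsubseteq> y" shows "\<^bold>G x \<sqsubseteq> \<^bold>G y"
  using assms G_meet[of x y] unfolding tle_def by simp

lemma le_F: assumes "x \<in> carrier A" "y \<in> carrier A" "x \<sqsubseteq> y" shows "\<^bold>F x \<sqsubseteq> \<^bold>F y"
  using assms F_join[of x y] by (simp add: le_iff_join F_closed)

lemma G_preimage_filter:
  assumes "prime_filter A S"
  shows "lattice_filter A {a \<in> carrier A. \<^bold>G a \<in> S}"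
proof -
  note SF = prime_filterD(1)[OF assms]
  show ?thesis
  proof (rule lattice_filterI)
    show "{a \<in> carrier A. \<^bold>G a \<in> S} \<noteq> {}"
      using filter_top[OF SF] top_closed G_top by auto
    show "y \<in> {a \<in> carrier A. \<^bold>G a \<in> S}"
      if "x \<in> {a \<in> carrier A. \<^bold>G a \<in> S}" "y \<in> carrier A" "x \<sqsubseteq> y" for x y
      using that le_G[of x y] G_closed[of y] prime_filter_mono[OF assms, of "\<^bold>G x" "\<^bold>G y"] by blast
    show "x \<sqinter> y \<in> {a \<in> carrier A. \<^bold>G a \<in> S}"
      if "x \<in> {a \<in> carrier A. \<^bold>G a \<in> S}" "y \<in> {a \<in> carrier A. \<^bold>G a \<in> S}" for x y
      using that meet_closed G_meet lattice_filterD(4)[OF SF] by auto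
  qed auto
qed

lemma F_preimage_complement_ideal:
  assumes "prime_filter A S"
  shows "lattice_ideal A {a \<in> carrier A. \<^bold>F a \<notin> S}"
proof (rule lattice_idealI)
  show "{a \<in> carrier A. \<^bold>F a \<notin> S} \<noteq> {}"
    using prime_filterD(2)[OF assms] bot_closed F_bot by auto
  show "y \<in> {a \<in> carrier A. \<^bold>F a \<notin> S}"
    if "x \<in> {a \<in> carrier A. \<^bold>F a \<notin> S}" "y \<in> carrier A" "y \<sqsubseteq> x" for x y
    using that le_F[of y x] F_closed[of x] prime_filter_mono[OF assms, of "\<^bold>F y" "\<^bold>F x"] by blast
  show "x \<squnion> y \<in> {a \<in> carrier A. \<^bold>F a \<notin> S}"
    if "x \<in> {a \<in> carrier A. \<^bold>F a \<notin> S}" "y \<in> {a \<in> carrier A. \<^bold>F a \<notin> S}" for x y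
    using that by (simp add: join_closed F_join F_closed prime_filter_join_iff[OF assms])
qed auto

text \<open>A suitable \<open>T\<close> must contain \<open>?U\<close>, avoid \<open>?V\<close> and
  avoid \<open>J\<close>, so \<open>?U\<close> is separated from the ideal \<open>?K\<close>
  generated by \<open>J\<close> and \<open>?V\<close>. If \<open>u\<close> is below
  \<open>j \<squnion> v\<close>, then \<open>G u\<close> is below \<open>G j \<squnion> F v\<close>,
  and primeness of \<open>S\<close> puts \<open>G j\<close> or \<open>F v\<close> into
  \<open>S\<close>; both are excluded.\<close>

lemma successor_avoiding_ideal:
  assumes S: "prime_filter A S" and J: "lattice_ideal A J" and GJ: "\<And>j. j \<in> J \<Longrightarrow> \<^bold>G j \<notin> S"
  obtains T where "(S, T) \<in> frame_rel (canonical_frame A)" "T \<inter> J = {}"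
proof -
  let ?U = "{a \<in> carrier A. \<^bold>G a \<in> S}" and ?V = "{a \<in> carrier A. \<^bold>F a \<notin> S}"
  let ?K = "{z \<in> carrier A. \<exists>i \<in> J. \<exists>j \<in> ?V. z \<sqsubseteq> i \<squnion> j}"
  note K = ideal_join[OF J F_preimage_complement_ideal[OF S]]
  have "?U \<inter> ?K = {}"
  proof (rule ccontr)
    assume "?U \<inter> ?K \<noteq> {}"
    then obtain u j v where *: "u \<in> carrier A" "\<^bold>G u \<in> S" "j \<in> J" "v \<in> carrier A" "\<^bold>F v \<notin> S"
      "u \<sqsubseteq> j \<squnion> v" by blast
    then have j: "j \<in> carrier A" using lattice_idealD(1)[OF J] by blast
    have "\<^bold>G (j \<squnion> v) \<in> S"
      using prime_filter_mono[OF S, of "\<^bold>G u"] * j by (simp add: le_G join_closed G_closed)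
    then have "\<^bold>G j \<squnion> \<^bold>F v \<in> S"
      using prime_filter_mono[OF S, of "\<^bold>G (j \<squnion> v)"] * j
      by (simp add: G_join_le join_closed G_closed F_closed)
    then show False
      using GJ * j by (simp add: prime_filter_join_iff[OF S] G_closed F_closed)
  qed
  then obtain T where T: "prime_filter A T" "?U \<subseteq> T" "T \<inter> ?K = {}"
    using prime_filter_separation[OF G_preimage_filter[OF S] K(1)] by blast
  have "T \<subseteq> {a \<in> carrier A. \<^bold>F a \<in> S}"
    using T(3) K(3) prime_filter_subset[OF T(1)] by blast
  then have "(S, T) \<in> frame_rel (canonical_frame A)"
    using S T by (simp add: canonical_frame_def prime_filters_def)
  then show ?thesis using that T(3) K(2) by blast
qed

text \<open>Here the filter side is enlarged: \<open>?K\<close> is generated by \<open>?G\<close>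
  and \<open>U\<close>, and is separated from \<open>?V\<close>. If \<open>g \<sqinter> u\<close>
  were below some \<open>v\<close> in \<open>?V\<close>, then \<open>G g \<sqinter> F u\<close>
  \<le> \<open>F (g \<sqinter> u)\<close> \<le> \<open>F v\<close> would put \<open>F v\<close> into
  \<open>S\<close>.\<close>

lemma successor_above_filter:
  assumes S: "prime_filter A S" and U: "lattice_filter A U" and FU: "\<And>u. u \<in> U \<Longrightarrow> \<^bold>F u \<in> S"
  obtains T where "(S, T) \<in> frame_rel (canonical_frame A)" "U \<subseteq> T"
proof -
  let ?G = "{a \<in> carrier A. \<^bold>G a \<in> S}" and ?V = "{a \<in> carrier A. \<^bold>F a \<notin> S}"
  let ?K = "{z \<in> carrier A. \<exists>g \<in> ?G. \<exists>u \<in> U. g \<sqinter> u \<sqsubseteq> z}"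
  note K = filter_join[OF G_preimage_filter[OF S] U]
  have "?K \<inter> ?V = {}"
  proof (rule ccontr)
    assume "?K \<inter> ?V \<noteq> {}"
    then obtain g u v where *: "g \<in> carrier A" "\<^bold>G g \<in> S" "u \<in> U" "v \<in> carrier A" "\<^bold>F v \<notin> S"
      "g \<sqinter> u \<sqsubseteq> v" by blast
    then have u: "u \<in> carrier A" using lattice_filterD(1)[OF U] by blast
    have "\<^bold>G g \<sqinter> \<^bold>F u \<in> S"
      using * u FU by (simp add: prime_filter_meet_iff[OF S] G_closed F_closed)
    then have "\<^bold>F (g \<sqinter> u) \<in> S"
      using prime_filter_mono[OF S, of "\<^bold>G g \<sqinter> \<^bold>F u"] * u
      by (simp add: G_meet_F_le meet_closed F_closed)
    then show False
      using prime_filter_mono[OF S, of "\<^bold>F (g \<sqinter> u)" "\<^bold>F v"] * u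
      by (simp add: le_F meet_closed F_closed)
  qed
  then obtain T where T: "prime_filter A T" "?K \<subseteq> T" "T \<inter> ?V = {}"
    using prime_filter_separation[OF K(1) F_preimage_complement_ideal[OF S]] by blast
  have "T \<subseteq> {a \<in> carrier A. \<^bold>F a \<in> S}"
    using T(3) prime_filter_subset[OF T(1)] by blast
  then have "(S, T) \<in> frame_rel (canonical_frame A)"
    using S T K(2) by (simp add: canonical_frame_def prime_filters_def)
  then show ?thesis using that T(2) K(3) by blast
qed

text \<open>The adjunctions rewrite the relation in terms of the past operators: \<open>H a\<close>
  in \<open>T\<close> gives \<open>F (H a)\<close> in \<open>S\<close>, which is below
  \<open>a\<close>; and \<open>a\<close> in \<open>S\<close> gives \<open>G (P a)\<close> in
  \<open>S\<close>, hence \<open>P a\<close> in \<open>T\<close>.\<close>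

lemma canonical_rel_imp_converse:
  assumes S: "prime_filter A S" and T: "prime_filter A T"
    and GF: "{a \<in> carrier A. \<^bold>G a \<in> S} \<subseteq> T" "T \<subseteq> {a \<in> carrier A. \<^bold>F a \<in> S}"
  shows "{a \<in> carrier A. \<^bold>H a \<in> T} \<subseteq> S" "S \<subseteq> {a \<in> carrier A. \<^bold>P a \<in> T}"
proof -
  show "{a \<in> carrier A. \<^bold>H a \<in> T} \<subseteq> S"
  proof clarify
    fix a assume "a \<in> carrier A" "\<^bold>H a \<in> T"
    then show "a \<in> S"
      using GF(2) F_H_le prime_filter_mono[OF S, of "\<^bold>F (\<^bold>H a)" a] by blast
  qed
  show "S \<subseteq> {a \<in> carrier A. \<^bold>P a \<in> T}"
  proof
    fix a assume "a \<in> S"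
    moreover from this have "a \<in> carrier A" using prime_filter_subset[OF S] by blast
    ultimately have "\<^bold>P a \<in> carrier A" "\<^bold>G (\<^bold>P a) \<in> S" "a \<in> carrier A"
      using prime_filter_mono[OF S, of a "\<^bold>G (\<^bold>P a)"] by (simp_all add: le_G_P P_closed G_closed)
    then show "a \<in> {a \<in> carrier A. \<^bold>P a \<in> T}" using GF(1) by blast
  qed
qed

end

lemma canonical_frame_simps:
  "points (canonical_frame A) = prime_filters A"
  "(S, T) \<in> frame_le (canonical_frame A) \<longleftrightarrow>
    S \<in> prime_filters A \<and> T \<in> prime_filters A \<and> S \<subseteq> T"
  "(S, T) \<in> frame_rel (canonical_frame A) \<longleftrightarrow>
    S \<in> prime_filters A \<and> T \<in> prime_filters A \<and>
    {a \<in> carrier A. \<^bold>G\<^bsub>A\<^esub> a \<in> S} \<subseteq> T \<and> T \<subseteq> {a \<in> carrier A. \<^bold>F\<^bsub>A\<^esub> a \<in> S}"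
  by (auto simp: canonical_frame_def)

text \<open>The bridge for all duality arguments. The two directions of \<open>rel\<close> are
  \<open>canonical_rel_imp_converse\<close> for \<open>A\<close> and for the reversed algebra with
  \<open>S\<close> and \<open>T\<close> exchanged.\<close>

lemma canonical_frame_reverse:
  assumes "tense_distributive_lattice A"
  shows "canonical_frame (reverse_algebra A) = reverse_frame (canonical_frame A)"
proof -
  interpret tense_distributive_lattice A by fact
  interpret rev: tense_distributive_lattice "reverse_algebra A"
    by (rule tense_distributive_lattice_reverse) fact
  have rel: "{a \<in> carrier A. \<^bold>G\<^bsub>A\<^esub> a \<in> S} \<subseteq> T \<and> T \<subseteq> {a \<in> carrier A. \<^bold>F\<^bsub>A\<^esub> a \<in> S} \<longleftrightarrow>
    {a \<in> carrier A. \<^bold>H\<^bsub>A\<^esub> a \<in> T} \<subseteq> S \<and> S \<subseteq> {a \<in> carrier A. \<^bold>P\<^bsub>A\<^esub> a \<in> T}"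
    if "S \<in> prime_filters A" "T \<in> prime_filters A" for S T
  proof -
    have ST: "prime_filter A S" "prime_filter A T"
      using that by (simp_all add: prime_filters_def)
    show ?thesis
      using canonical_rel_imp_converse[OF ST]
        rev.canonical_rel_imp_converse[unfolded reverse_algebra_simps prime_filter_reverse, OF ST(2,1)]
      by (intro iffI conjI) blast+
  qed
  have "(S, T) \<in> frame_rel (canonical_frame (reverse_algebra A)) \<longleftrightarrow>
    (T, S) \<in> frame_rel (canonical_frame A)" for S T
    unfolding canonical_frame_simps prime_filters_reverse reverse_algebra_simps
    using rel[of T S] by argo
  then have "frame_rel (canonical_frame (reverse_algebra A)) = (frame_rel (canonical_frame A))\<inverse>"
    by auto
  then show ?thesis
    by (intro tense_frame.equality) (simp_all add: canonical_frame_def)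
qed

section \<open>The canonical frame and its complex algebra\<close>

lemma complex_algebra_simps [simp]:
  "carrier (complex_algebra X) = upsets X"
  "tmeet (complex_algebra X) = (\<inter>)" "tjoin (complex_algebra X) = (\<union>)"
  "tbot (complex_algebra X) = {}" "ttop (complex_algebra X) = points X"
  "opG (complex_algebra X) Y = {x \<in> points X. R_im X {x} \<subseteq> Y}"
  "opH (complex_algebra X) Y = {x \<in> points X. R_inv_im X {x} \<subseteq> Y}"
  "opF (complex_algebra X) Y = {x \<in> points X. R_im X {x} \<inter> Y \<noteq> {}}"
  "opP (complex_algebra X) Y = {x \<in> points X. R_inv_im X {x} \<inter> Y \<noteq> {}}"
  by (simp_all add: complex_algebra_def)

lemma complex_algebra_le [simp]: "U \<sqsubseteq>\<^bsub>complex_algebra X\<^esub> V \<longleftrightarrow> U \<subseteq> V"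
  unfolding tle_def by auto

section \<open>The future half: (K1), (K3), and preservation of \<open>G\<close> and
  \<open>F\<close>\<close>

context tense_distributive_lattice
begin

text \<open>Being local to the locale, it also provides \<open>rev.M\<close> for the canonical frame
  of the reversed algebra once the locale is interpreted a second time.\<close>

abbreviation "M \<equiv> canonical_frame A"

lemma prime_filters_iff: "S \<in> prime_filters A \<longleftrightarrow> prime_filter A S"
  by (simp add: prime_filters_def)

text \<open>\<open>T'\<close> is a successor of \<open>S\<close> that avoids the complement of
  \<open>T\<close>. One exists because \<open>G j\<close> in \<open>S\<close>, hence in
  \<open>S'\<close>, forces \<open>j\<close> into \<open>T\<close>.\<close>

lemma canonical_K1:
  assumes "(S, S') \<in> frame_le M" "(S', T) \<in> frame_rel M"
  obtains T' where "(S, T') \<in> frame_rel M" "(T', T) \<in> frame_le M"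
proof -
  have S: "prime_filter A S" and T: "prime_filter A T"
    using assms by (auto simp: canonical_frame_simps prime_filters_iff)
  obtain T' where T': "(S, T') \<in> frame_rel M" "T' \<inter> (carrier A - T) = {}"
    using successor_avoiding_ideal[OF S prime_filter_complement_ideal[OF T]] assms
    by (force simp: canonical_frame_simps)
  then have "(T', T) \<in> frame_le M"
    using T by (auto simp: canonical_frame_simps prime_filters_iff)
  then show ?thesis using that T' by blast
qed

text \<open>\<open>T'\<close> is a successor of \<open>S\<close> that contains \<open>T\<close>. One
  exists because \<open>u\<close> in \<open>T\<close> forces \<open>F u\<close> into
  \<open>S'\<close>, hence into \<open>S\<close>.\<close>

lemma canonical_K3:
  assumes "(S', S) \<in> frame_le M" "(S', T) \<in> frame_rel M"
  obtains T' where "(S, T') \<in> frame_rel M" "(T, T') \<in> frame_le M"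
proof -
  have S: "prime_filter A S" and T: "prime_filter A T"
    using assms by (auto simp: canonical_frame_simps prime_filters_iff)
  obtain T' where T': "(S, T') \<in> frame_rel M" "T \<subseteq> T'"
    using successor_above_filter[OF S prime_filterD(1)[OF T]] assms
    by (force simp: canonical_frame_simps)
  then have "(T, T') \<in> frame_le M"
    using T by (auto simp: canonical_frame_simps prime_filters_iff)
  then show ?thesis using that T' by blast
qed

text \<open>One inclusion is built into the canonical relation. For the other, if \<open>G a\<close>
  is not in \<open>S\<close>, monotonicity of \<open>G\<close> allows a successor that avoids the
  principal ideal of \<open>a\<close>, and in particular \<open>a\<close>.\<close>

lemma rep_algebra_G:
  assumes "a \<in> carrier A"
  shows "rep_algebra A (\<^bold>G a) = \<^bold>G\<^bsub>complex_algebra M\<^esub> (rep_algebra A a)"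
proof -
  have "\<^bold>G a \<in> S" if S: "prime_filter A S" and R: "R_im M {S} \<subseteq> rep_algebra A a" for S
  proof (rule ccontr)
    assume n: "\<^bold>G a \<notin> S"
    have "\<^bold>G j \<notin> S" if "j \<in> {x \<in> carrier A. x \<sqsubseteq> a}" for j
      using that n assms le_G[of j a] G_closed[of a] prime_filter_mono[OF S, of "\<^bold>G j" "\<^bold>G a"] by blast
    then obtain T where "(S, T) \<in> frame_rel M" "T \<inter> {x \<in> carrier A. x \<sqsubseteq> a} = {}"
      using successor_avoiding_ideal[OF S principal_ideal[OF assms]] by blast
    then show False
      using R assms le_refl[OF assms] unfolding rep_algebra_def by blast
  qed
  then show ?thesis
    using assms by (auto simp: rep_algebra_def canonical_frame_simps prime_filters_iff)
qed

text \<open>Dually, \<open>F a\<close> in \<open>S\<close> allows a successor that contains the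
  principal filter of \<open>a\<close>.\<close>

lemma rep_algebra_F:
  assumes "a \<in> carrier A"
  shows "rep_algebra A (\<^bold>F a) = \<^bold>F\<^bsub>complex_algebra M\<^esub> (rep_algebra A a)"
proof -
  have "R_im M {S} \<inter> rep_algebra A a \<noteq> {}" if S: "prime_filter A S" and F: "\<^bold>F a \<in> S" for S
  proof -
    have "\<^bold>F u \<in> S" if "u \<in> {x \<in> carrier A. a \<sqsubseteq> x}" for u
      using that F assms le_F[of a u] F_closed[of u] prime_filter_mono[OF S, of "\<^bold>F a" "\<^bold>F u"] by blast
    then obtain T where T: "(S, T) \<in> frame_rel M" "{x \<in> carrier A. a \<sqsubseteq> x} \<subseteq> T"
      using successor_above_filter[OF S principal_filter[OF assms]] by blast
    then have "T \<in> R_im M {S} \<inter> rep_algebra A a"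
      using assms le_refl by (auto simp: rep_algebra_def canonical_frame_simps)
    then show ?thesis by blast
  qed
  then show ?thesis
    using assms by (auto simp: rep_algebra_def canonical_frame_simps prime_filters_iff)
qed

end

theorem tDL_frame_canonical:
  assumes "tense_distributive_lattice A"
  shows "tDL_frame (canonical_frame A)"
proof -
  interpret tense_distributive_lattice A by fact
  interpret rev: tense_distributive_lattice "reverse_algebra A"
    by (rule tense_distributive_lattice_reverse) fact
  have rev_eq: "rev.M = reverse_frame M"
    by (rule canonical_frame_reverse) fact
  show ?thesis
  proof
    show "partial_order_on (points M) (frame_le M)"
      unfolding partial_order_on_def preorder_on_def refl_on_def trans_def antisym_def
      by (auto simp: canonical_frame_simps)
    show "frame_rel M \<subseteq> points M \<times> points M"
      by (auto simp: canonical_frame_simps)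
    show "R_im M (upcl M {x}) \<subseteq> upcl M (R_im M {x})" for x
      by (auto elim: canonical_K1)
    \<comment> \<open>(K2) is (K1) for the reversed algebra, whose canonical relation is the
      converse; (K4) follows from (K3) in the same way.\<close>
    show "R_inv_im M (upcl M {x}) \<subseteq> upcl M (R_inv_im M {x})" for x
      using rev.canonical_K1 unfolding rev_eq by auto blast
    show "R_im M (downcl M {x}) \<subseteq> downcl M (R_im M {x})" for x
      by (auto elim: canonical_K3)
    show "R_inv_im M (downcl M {x}) \<subseteq> downcl M (R_inv_im M {x})" for x
      using rev.canonical_K3 unfolding rev_eq by auto blast
    \<comment> \<open>The successors of a prime filter are those between two fixed sets, so they
      form a convex family.\<close>
    show "R_im M {x} = upcl M (R_im M {x}) \<inter> downcl M (R_im M {x})" for x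
      by (auto simp: canonical_frame_simps) blast+
  qed
qed

theorem rep_algebra_embedding:
  assumes "tense_distributive_lattice A"
  shows "tense_embedding A (complex_algebra (canonical_frame A)) (rep_algebra A)"
proof -
  interpret tense_distributive_lattice A by fact
  interpret rev: tense_distributive_lattice "reverse_algebra A"
    by (rule tense_distributive_lattice_reverse) fact
  have rev_eq: "rev.M = reverse_frame M"
    by (rule canonical_frame_reverse) fact
  have rep_rev: "rep_algebra (reverse_algebra A) = rep_algebra A"
    by (simp add: rep_algebra_def fun_eq_iff)
  \<comment> \<open>\<open>H\<close> and \<open>P\<close> are \<open>G\<close> and \<open>F\<close>
    of the reversed algebra, and \<open>rep_algebra\<close> is unchanged by reversal.\<close>
  have "rep_algebra A (\<^bold>H\<^bsub>A\<^esub> a) = \<^bold>H\<^bsub>complex_algebra M\<^esub> (rep_algebra A a)" if "a \<in> carrier A" for a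
    using rev.rep_algebra_G[of a] that
    unfolding rev_eq rep_rev complex_algebra_reverse reverse_algebra_simps .
  moreover have "rep_algebra A (\<^bold>P\<^bsub>A\<^esub> a) = \<^bold>P\<^bsub>complex_algebra M\<^esub> (rep_algebra A a)" if "a \<in> carrier A" for a
    using rev.rep_algebra_F[of a] that
    unfolding rev_eq rep_rev complex_algebra_reverse reverse_algebra_simps .
  moreover have "rep_algebra A a \<in> upsets M" for a
    by (auto simp: rep_algebra_def upsets_def canonical_frame_simps)
  moreover have "rep_algebra A (a \<sqinter>\<^bsub>A\<^esub> b) = rep_algebra A a \<inter> rep_algebra A b"
    "rep_algebra A (a \<squnion>\<^bsub>A\<^esub> b) = rep_algebra A a \<union> rep_algebra A b"
    if "a \<in> carrier A" "b \<in> carrier A" for a b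
    using that prime_filter_meet_iff prime_filter_join_iff
    by (auto simp: rep_algebra_def prime_filters_iff)
  moreover have "rep_algebra A \<bottom>\<^bsub>A\<^esub> = {}" "rep_algebra A \<top>\<^bsub>A\<^esub> = points M"
    using prime_filterD filter_top
    by (auto simp: rep_algebra_def prime_filters_iff canonical_frame_simps)
  moreover have "inj_on (rep_algebra A) (carrier A)"
  proof (rule inj_onI)
    fix a b assume ab: "a \<in> carrier A" "b \<in> carrier A" and eq: "rep_algebra A a = rep_algebra A b"
    have "a \<in> T \<longleftrightarrow> b \<in> T" if "prime_filter A T" for T
      using eq that by (auto simp: rep_algebra_def prime_filters_iff set_eq_iff)
    then have "a \<sqsubseteq>\<^bsub>A\<^esub> b" "b \<sqsubseteq>\<^bsub>A\<^esub> a"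
      using prime_filters_separate ab by metis+
    then show "a = b" using le_antisym ab by blast
  qed
  ultimately show ?thesis
    unfolding tense_embedding_def tense_hom_def
    using rep_algebra_G rep_algebra_F
    by (simp only: mem_Collect_eq Pi_iff complex_algebra_simps(1-5)) simp
qed

text \<open>
  In the finite case every prime filter \<open>T\<close> contains its own meet \<open>t\<close>, and \<open>h t\<close> is the
  principal up-set of \<open>T\<close>; joins of such elements give all up-sets.
\<close>

lemma rep_algebra_surj:
  assumes "tense_distributive_lattice A" and fin: "finite (carrier A)"
  shows "upsets (canonical_frame A) \<subseteq> rep_algebra A ` carrier A"
proof
  interpret tense_distributive_lattice A by fact
  note sub = prime_filter_subset
  have principal: "\<exists>t \<in> carrier A. rep_algebra A t = {T' \<in> prime_filters A. T \<subseteq> T'}"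
    if T: "prime_filter A T" for T
  proof -
    obtain t where t: "t \<in> T" "\<And>w. w \<in> T \<Longrightarrow> t \<sqsubseteq>\<^bsub>A\<^esub> w"
      using finite_filter_lower_bound[OF prime_filterD(1)[OF T], of T] sub[OF T] fin finite_subset by blast
    then have "rep_algebra A t = {T' \<in> prime_filters A. T \<subseteq> T'}"
      using sub[OF T] prime_filter_mono by (auto simp: rep_algebra_def prime_filters_iff)
    then show ?thesis using t sub[OF T] by blast
  qed
  fix U assume U: "U \<in> upsets (canonical_frame A)"
  have "prime_filters A \<subseteq> Pow (carrier A)"
    using sub prime_filters_iff by blast
  moreover have Usub: "U \<subseteq> prime_filters A"
    using U by (simp add: upsets_def canonical_frame_simps)
  ultimately have "finite U" using fin by (meson finite_Pow_iff finite_subset)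
  \<comment> \<open>The induction passes through subsets of \<open>U\<close> that need not be
    up-sets, hence the statement about generated up-sets.\<close>
  then have "\<exists>a \<in> carrier A. rep_algebra A a = {T' \<in> prime_filters A. \<exists>T \<in> U. T \<subseteq> T'}"
    using Usub
  proof (induction U)
    case empty
    have "rep_algebra A \<bottom>\<^bsub>A\<^esub> = {}"
      using prime_filterD(2) by (auto simp: rep_algebra_def prime_filters_iff)
    then show ?case using bot_closed by auto
  next
    case (insert T U)
    then obtain a where a: "a \<in> carrier A"
      "rep_algebra A a = {T' \<in> prime_filters A. \<exists>T \<in> U. T \<subseteq> T'}" by blast
    obtain t where t: "t \<in> carrier A" "rep_algebra A t = {T' \<in> prime_filters A. T \<subseteq> T'}"
      using principal[of T] insert.prems by (auto simp: prime_filters_iff)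
    have "rep_algebra A (a \<squnion>\<^bsub>A\<^esub> t) = rep_algebra A a \<union> rep_algebra A t"
      using a(1) t(1) prime_filter_join_iff by (auto simp: rep_algebra_def prime_filters_iff)
    then have "rep_algebra A (a \<squnion>\<^bsub>A\<^esub> t) = {T' \<in> prime_filters A. \<exists>S \<in> insert T U. S \<subseteq> T'}"
      unfolding a(2) t(2) by blast
    then show ?case using join_closed[OF a(1) t(1)] by blast
  qed
  moreover have "{T' \<in> prime_filters A. \<exists>T \<in> U. T \<subseteq> T'} = U"
    using U by (auto simp: upsets_def canonical_frame_simps)
  ultimately show "U \<in> rep_algebra A ` carrier A" by auto
qed

section \<open>The complex algebra and its canonical frame\<close>

context tDL_frame
begin

lemma le_refl: "x \<in> points X \<Longrightarrow> (x, x) \<in> frame_le X"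
  using poset by (simp add: partial_order_on_def preorder_on_def refl_on_def)

lemma le_trans: "\<lbrakk>(x, y) \<in> frame_le X; (y, z) \<in> frame_le X\<rbrakk> \<Longrightarrow> (x, z) \<in> frame_le X"
  using poset unfolding partial_order_on_def preorder_on_def trans_def by blast

lemma le_antisym: "\<lbrakk>(x, y) \<in> frame_le X; (y, x) \<in> frame_le X\<rbrakk> \<Longrightarrow> x = y"
  using poset unfolding partial_order_on_def antisym_def by blast

lemma le_points: "(x, y) \<in> frame_le X \<Longrightarrow> x \<in> points X \<and> y \<in> points X"
  using poset unfolding partial_order_on_def preorder_on_def refl_on_def by blast

lemma upsetD: "\<lbrakk>U \<in> upsets X; x \<in> U; (x, y) \<in> frame_le X\<rbrakk> \<Longrightarrow> y \<in> U"
  unfolding upsets_def by blast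

lemma upset_points: "U \<in> upsets X \<Longrightarrow> U \<subseteq> points X"
  unfolding upsets_def by blast

lemma empty_upset: "{} \<in> upsets X"
  unfolding upsets_def by blast

lemma points_upset: "points X \<in> upsets X"
  unfolding upsets_def using le_points by blast

lemma Int_upset: "\<lbrakk>U \<in> upsets X; V \<in> upsets X\<rbrakk> \<Longrightarrow> U \<inter> V \<in> upsets X"
  unfolding upsets_def by blast

lemma Un_upset: "\<lbrakk>U \<in> upsets X; V \<in> upsets X\<rbrakk> \<Longrightarrow> U \<union> V \<in> upsets X"
  unfolding upsets_def by blast

lemma upcl_upset: "upcl X Y \<in> upsets X"
  unfolding upsets_def using le_trans le_points by blast

lemma Compl_downcl_upset: "points X - downcl X Y \<in> upsets X"
  unfolding upsets_def using le_trans le_points by blast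

text \<open>(K1) to (K4) give, in this order, closure under \<open>G\<close>, \<open>H\<close>,
  \<open>F\<close> and \<open>P\<close>. Here, if \<open>x\<close> \<le> \<open>y\<close>, each
  successor of \<open>y\<close> lies above a successor of \<open>x\<close>; for \<open>F\<close>,
  each successor of \<open>x\<close> lies below a successor of \<open>y\<close>.\<close>

lemma G_upset:
  assumes "U \<in> upsets X" shows "{x \<in> points X. R_im X {x} \<subseteq> U} \<in> upsets X"
proof -
  have "R_im X {y} \<subseteq> U" if "x \<in> points X" "R_im X {x} \<subseteq> U" "(x, y) \<in> frame_le X" for x y
    using K1[of x] upsetD[OF assms] that by blast
  then show ?thesis unfolding upsets_def using le_points by blast
qed

lemma H_upset:
  assumes "U \<in> upsets X" shows "{x \<in> points X. R_inv_im X {x} \<subseteq> U} \<in> upsets X"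
proof -
  have "R_inv_im X {y} \<subseteq> U" if "x \<in> points X" "R_inv_im X {x} \<subseteq> U" "(x, y) \<in> frame_le X" for x y
    using K2[of x] upsetD[OF assms] that by blast
  then show ?thesis unfolding upsets_def using le_points by blast
qed

lemma F_upset:
  assumes "U \<in> upsets X" shows "{x \<in> points X. R_im X {x} \<inter> U \<noteq> {}} \<in> upsets X"
proof -
  have "R_im X {y} \<inter> U \<noteq> {}" if "R_im X {x} \<inter> U \<noteq> {}" "(x, y) \<in> frame_le X" for x y
    using K3[of y] upsetD[OF assms] that le_points[OF that(2)] by blast
  then show ?thesis unfolding upsets_def using le_points by blast
qed

lemma P_upset:
  assumes "U \<in> upsets X" shows "{x \<in> points X. R_inv_im X {x} \<inter> U \<noteq> {}} \<in> upsets X"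
proof -
  have "R_inv_im X {y} \<inter> U \<noteq> {}" if "R_inv_im X {x} \<inter> U \<noteq> {}" "(x, y) \<in> frame_le X" for x y
    using K4[of y] upsetD[OF assms] that le_points[OF that(2)] by blast
  then show ?thesis unfolding upsets_def using le_points by blast
qed

text \<open>(K1) to (K4) enter through closure under the operators. The other tense axioms are
  inclusions and equations valid for any relation on the points and its converse.\<close>

theorem tense_distributive_lattice_complex: "tense_distributive_lattice (complex_algebra X)"
  by (unfold_locales; unfold complex_algebra_simps complex_algebra_le;
    ((rule G_upset H_upset F_upset P_upset Int_upset Un_upset empty_upset points_upset; assumption)
      | (use upset_points rel_on_points in blast)))

lemma rep_frame_prime_filter:
  assumes "x \<in> points X"
  shows "prime_filter (complex_algebra X) (rep_frame X x)"
  using assms points_upset empty_upset Int_upset unfolding prime_filter_def rep_frame_def by auto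

text \<open>The test set for order reflection is the principal up-set of \<open>x\<close>.\<close>

lemma rep_frame_le_iff:
  assumes "x \<in> points X" "y \<in> points X"
  shows "rep_frame X x \<subseteq> rep_frame X y \<longleftrightarrow> (x, y) \<in> frame_le X"
  using assms upcl_upset[of "{x}"] le_refl upsetD unfolding rep_frame_def by blast

text \<open>Two test up-sets recover the relation. Since \<open>x\<close> lies in \<open>G\<close>
  of the up-closure of R(x), \<open>y\<close> lies in that up-closure. If \<open>y\<close> lay
  outside the down-closure of R(x), then \<open>x\<close> would lie in \<open>F\<close> of its
  complement, although R(x) is inside the down-closure. (K5) combines both facts.\<close>

lemma rep_frame_rel_iff:
  assumes x: "x \<in> points X" and y: "y \<in> points X"
  shows "(rep_frame X x, rep_frame X y) \<in> frame_rel (canonical_frame (complex_algebra X)) \<longleftrightarrow>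
    (x, y) \<in> frame_rel X"
proof
  assume R: "(rep_frame X x, rep_frame X y) \<in> frame_rel (canonical_frame (complex_algebra X))"
  have "upcl X (R_im X {x}) \<supseteq> R_im X {x}"
    using rel_on_points le_refl by blast
  then have up: "y \<in> upcl X (R_im X {x})"
    using R x upcl_upset[of "R_im X {x}"] G_upset[OF upcl_upset, of "R_im X {x}"]
    by (auto simp: canonical_frame_simps rep_frame_def)
  have "downcl X (R_im X {x}) \<supseteq> R_im X {x}"
    using rel_on_points le_refl by blast
  then have down: "y \<in> downcl X (R_im X {x})"
    using R y Compl_downcl_upset[of "R_im X {x}"]
    by (auto simp: canonical_frame_simps rep_frame_def)
  show "(x, y) \<in> frame_rel X"
    using K5[OF x] up down by blast
next
  assume "(x, y) \<in> frame_rel X"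
  then show "(rep_frame X x, rep_frame X y) \<in> frame_rel (canonical_frame (complex_algebra X))"
    using x y rep_frame_prime_filter F_upset
    by (auto simp: canonical_frame_simps prime_filters_def rep_frame_def)
qed

theorem rep_frame_embedding: "frame_embedding X (canonical_frame (complex_algebra X)) (rep_frame X)"
  unfolding frame_embedding_def
  using rep_frame_rel_iff rep_frame_le_iff rep_frame_prime_filter
  by (auto simp: canonical_frame_simps prime_filters_def)

text \<open>
  In the finite case a prime filter \<open>S\<close> of up-sets has a least member, which is the union of
  its principal up-sets; primeness puts one of these into \<open>S\<close>.
\<close>

lemma rep_frame_surj:
  assumes fin: "finite (points X)" and S: "prime_filter (complex_algebra X) S"
  shows "S \<in> rep_frame X ` points X"
proof -
  interpret C: tense_distributive_lattice "complex_algebra X"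
    by (rule tense_distributive_lattice_complex)
  note SD = lattice_filterD[OF C.prime_filterD(1)[OF S], unfolded complex_algebra_simps complex_algebra_le]
  have "S \<subseteq> Pow (points X)"
    using SD(1) upset_points by blast
  then have "finite S" using fin by (meson finite_Pow_iff finite_subset)
  then obtain W where W: "W \<in> S" "\<And>V. V \<in> S \<Longrightarrow> W \<subseteq> V"
    using C.finite_filter_lower_bound[OF C.prime_filterD(1)[OF S], of S] by auto
  have Wup: "W \<in> upsets X" using W SD(1) by blast
  \<comment> \<open>Stated for arbitrary finite \<open>V\<close>, as removing a point may destroy an
    up-set. The empty case would put the bottom element into \<open>S\<close>.\<close>
  have "\<exists>x \<in> V. upcl X {x} \<in> S" if "finite V" "upcl X V \<in> S" for V
    using that
  proof (induction V)
    case empty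
    then show ?case using C.prime_filterD(2)[OF S] by simp
  next
    case (insert x V)
    have "upcl X (insert x V) = upcl X {x} \<union> upcl X V" by blast
    then have "upcl X {x} \<in> S \<or> upcl X V \<in> S"
      using C.prime_filterD(3)[OF S, of "upcl X {x}" "upcl X V"] insert.prems upcl_upset by simp
    then show ?case using insert.IH by blast
  qed
  moreover have "upcl X W = W"
    using le_refl upsetD[OF Wup] upset_points[OF Wup] by blast
  moreover have "finite W" using fin upset_points[OF Wup] finite_subset by blast
  ultimately obtain x where x: "x \<in> W" "upcl X {x} \<in> S" using W(1) by metis
  have "S = rep_frame X x"
  proof
    show "S \<subseteq> rep_frame X x"
      using W(2) x(1) SD(1) unfolding rep_frame_def by blast
    show "rep_frame X x \<subseteq> S"
    proof
      fix U assume "U \<in> rep_frame X x"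
      then have "U \<in> upsets X" "upcl X {x} \<subseteq> U"
        using upsetD unfolding rep_frame_def by blast+
      then show "U \<in> S" using SD(3)[OF x(2)] by blast
    qed
  qed
  then show ?thesis using x(1) upset_points[OF Wup] by blast
qed

theorem rep_frame_iso:
  assumes "finite (points X)"
  shows "frame_iso X (canonical_frame (complex_algebra X)) (rep_frame X)"
proof -
  have "inj_on (rep_frame X) (points X)"
    using rep_frame_le_iff le_antisym by (metis inj_onI order_refl)
  moreover have "rep_frame X ` points X = prime_filters (complex_algebra X)"
    using rep_frame_prime_filter rep_frame_surj[OF assms] by (auto simp: prime_filters_def)
  ultimately show ?thesis
    using rep_frame_embedding by (simp add: frame_iso_def bij_betw_def canonical_frame_simps)
qed

end

theorem rep_algebra_iso:
  assumes "tense_distributive_lattice A" "finite (carrier A)"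
  shows "tense_iso A (complex_algebra (canonical_frame A)) (rep_algebra A)"
  using rep_algebra_embedding[OF assms(1)] rep_algebra_surj[OF assms]
  by (auto simp: tense_embedding_def tense_iso_def tense_hom_def bij_betw_def)

theorem theorem5p14:
  fixes A :: "'a tense_algebra" and X :: "'x tense_frame"
  assumes "tense_distributive_lattice A" and "tDL_frame X"
  shows "tDL_frame (canonical_frame A) \<and>
    tense_distributive_lattice (complex_algebra X) \<and>
    tense_embedding A (complex_algebra (canonical_frame A)) (rep_algebra A) \<and>
    (finite (carrier A) \<longrightarrow>
      tense_iso A (complex_algebra (canonical_frame A)) (rep_algebra A)) \<and>
    frame_embedding X (canonical_frame (complex_algebra X)) (rep_frame X) \<and>
    (finite (points X) \<longrightarrow>
      frame_iso X (canonical_frame (complex_algebra X)) (rep_frame X))"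
  using assms tDL_frame_canonical rep_algebra_embedding rep_algebra_iso
    tDL_frame.tense_distributive_lattice_complex tDL_frame.rep_frame_embedding tDL_frame.rep_frame_iso
  by blast

end
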